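(* If $f\in\mathcal{S}^*_{\wp}$, then $f\in\Omega$ in the disc $|z|<r_0$, i.e. $|zf'(z)-f(z)|<\frac12$ for all $|z|<r_0$, where $r_0\approx0.43384$ is the smallest positive root of $2r^2e^{e^r+r-1}-1=0$. This result is sharp, i.e. $r_0$ cannot be replaced by a larger number.
   Context: $\mathbb{D}=\{z\in\mathbb{C}:|z|<1\}$. $\mathcal{A}$ is the class of analytic functions $f$ on $\mathbb{D}$ with $f(0)=0$, $f'(0)=1$. $\Omega=\{f\in\mathcal{A}:|zf'(z)-f(z)|<\frac12,\ z\in\mathbb{D}\}$; "$f\in\Omega$ in the disc $|z|<r_0$" means that the defining inequality holds for all $|z|<r_0$. $\mathcal{S}^*_{\wp}$ is the class of $f\in\mathcal{A}$ with $zf'(z)/f(z)\prec 1+ze^z$, where $p\prec\phi$ means $p=\phi\circ\omega$ for some analytic $\omega:\mathbb{D}\to\mathbb{D}$ with $\omega(0)=0$. *)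

theory Defs
  imports "HOL-Complex_Analysis.Complex_Analysis"
begin

abbreviation unit_disc :: "complex set" where
  "unit_disc \<equiv> ball 0 1"

definition class_A :: "(complex \<Rightarrow> complex) set" where
  "class_A = {f. f holomorphic_on unit_disc \<and> f 0 = 0 \<and> deriv f 0 = 1}"

definition subordinate :: "(complex \<Rightarrow> complex) \<Rightarrow> (complex \<Rightarrow> complex) \<Rightarrow> bool" where
  "subordinate p \<phi> \<longleftrightarrow>
     (\<exists>\<omega>. \<omega> holomorphic_on unit_disc \<and> \<omega> ` unit_disc \<subseteq> unit_disc \<and> \<omega> 0 = 0 \<and>
          (\<forall>z\<in>unit_disc. p z = \<phi> (\<omega> z)))"

(* z f'(z) / f(z) has a removable singularity at 0 when f is in class_A; its value there is 1,
   whereas the HOL quotient 0 / 0 would be 0. *)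
definition starlike_quotient :: "(complex \<Rightarrow> complex) \<Rightarrow> complex \<Rightarrow> complex" where
  "starlike_quotient f z = (if z = 0 then 1 else z * deriv f z / f z)"

(* The paper's condition presupposes that z f'(z) / f(z) is defined throughout the disc;
   since HOL division is total, the absence of further zeros of f is stated explicitly. *)
definition class_S_wp :: "(complex \<Rightarrow> complex) set" where
  "class_S_wp = {f \<in> class_A. (\<forall>z\<in>unit_disc - {0}. f z \<noteq> 0) \<and>
     subordinate (starlike_quotient f) (\<lambda>z. 1 + z * exp z)}"

(* "f belongs to Omega in the disc of radius r". Functions in class_A are only meaningful on
   the unit disc, so points outside it are ignored. *)
definition in_Omega_disc :: "real \<Rightarrow> (complex \<Rightarrow> complex) \<Rightarrow> bool" where
  "in_Omega_disc r f \<longleftrightarrow>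
     f \<in> class_A \<and> (\<forall>z\<in>unit_disc. norm z < r \<longrightarrow> norm (z * deriv f z - f z) < 1 / 2)"

end

theory Submission
  imports Defs
begin

text \<open>
  If \<open>f \<in> class_S_wp\<close> then \<open>z f'(z) / f(z) - 1 = \<omega>(z) exp (\<omega>(z))\<close> with
  \<open>|\<omega>(z)| \<le> |z|\<close> by the Schwarz lemma. Writing \<open>f(z) = z exp (g(z))\<close>, this says
  \<open>z g'(z) = \<omega>(z) exp (\<omega>(z))\<close>, so \<open>|g'(z)| \<le> exp |z|\<close>; integrating along the radius gives
  \<open>|f(z)| \<le> |z| exp (exp |z| - 1)\<close>. Hence \<open>|z f'(z) - f(z)| \<le> r\<^sup>2 exp (exp r + r - 1)\<close> for
  \<open>r = |z|\<close>, and \<open>f(z) = z exp (exp z - 1)\<close> attains equality at \<open>z = r\<close>.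
\<close>

text \<open>Lagrange remainder: its factor \<open>exp t\<close> is positive and at most 3 for
  \<open>t\<close> in the unit interval. Only rational arithmetic is then left in the numerical
  estimates of \<open>exp\<close>.\<close>

lemma exp_Taylor_bounds:
  fixes x :: real
  assumes "0 \<le> x" "x \<le> 1"
  shows "(\<Sum>m<n. x ^ m / fact m) \<le> exp x"
    and "exp x \<le> (\<Sum>m<n. x ^ m / fact m) + 3 / fact n * x ^ n"
proof -
  obtain t where t: "\<bar>t\<bar> \<le> \<bar>x\<bar>"
    and eq: "exp x = (\<Sum>m<n. x ^ m / fact m) + (exp t / fact n) * x ^ n"
    using Maclaurin_exp_le by blast
  have "exp t \<le> exp 1" using t assms by simp
  then have "exp t \<le> 3" using exp_le by linarith
  then have "(exp t / fact n) * x ^ n \<le> 3 / fact n * x ^ n"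
    using assms by (intro mult_right_mono divide_right_mono) auto
  then show "exp x \<le> (\<Sum>m<n. x ^ m / fact m) + 3 / fact n * x ^ n" using eq by simp
  show "(\<Sum>m<n. x ^ m / fact m) \<le> exp x" using eq assms by simp
qed

text \<open>The equation defining the radius reads \<open>2 * omega_bound r - 1 = 0\<close>;
  factoring out 1/2 lets this function serve directly as the sharp majorant.\<close>

definition omega_bound :: "real \<Rightarrow> real" where
  "omega_bound r = r\<^sup>2 * exp (exp r + r - 1)"

lemma omega_bound_strict_mono:
  assumes "0 \<le> r" "r < s"
  shows "omega_bound r < omega_bound s"
proof -
  have "exp (exp r + r - 1) \<le> exp (exp s + s - 1)"
    using assms by (simp add: add_mono)
  moreover have "r\<^sup>2 < s\<^sup>2" using assms by (simp add: power_strict_mono)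
  ultimately show ?thesis
    unfolding omega_bound_def by (intro mult_less_le_imp_less) auto
qed

text \<open>The argument is 0.43384 - 0.000005. With 9 and 12 Taylor terms both remainders stay
  below 1e-8, while the margin to 1/2 exceeds 1e-5.\<close>

lemma omega_bound_lower: "omega_bound 0.433835 < 1 / 2"
proof -
  have "exp (0.433835::real) \<le> 1.543165"
    by (rule order_trans[OF exp_Taylor_bounds(2)[where n = 9]])
       (simp_all add: eval_nat_numeral fact_numeral)
  \<comment> \<open>The constant is exactly 1.543165 + 0.433835 - 1.\<close>
  then have "exp (exp 0.433835 + 0.433835 - 1) \<le> exp (0.977::real)"
    by simp
  also have "exp (0.977::real) \<le> 2.656475"
    by (rule order_trans[OF exp_Taylor_bounds(2)[where n = 12]])
       (simp_all add: eval_nat_numeral fact_numeral)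
  finally have "omega_bound 0.433835 \<le> 0.433835\<^sup>2 * 2.656475"
    unfolding omega_bound_def by (intro mult_left_mono) auto
  also have "\<dots> < 1 / 2" by (simp add: power2_eq_square)
  finally show ?thesis .
qed

lemma omega_bound_upper: "omega_bound 0.433845 > 1 / 2"
proof -
  have "exp (0.433845::real) \<ge> 1.543179"
    by (rule order_trans[OF _ exp_Taylor_bounds(1)[where n = 9]])
       (simp_all add: eval_nat_numeral fact_numeral)
  \<comment> \<open>Here 1.543179 + 0.433845 - 1 = 0.977024, rounded down.\<close>
  then have "exp (exp 0.433845 + 0.433845 - 1) \<ge> exp (0.97702::real)"
    by simp
  moreover have "exp (0.97702::real) \<ge> 2.65652"
    by (rule order_trans[OF _ exp_Taylor_bounds(1)[where n = 12]])
       (simp_all add: eval_nat_numeral fact_numeral)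
  ultimately have "exp (exp 0.433845 + 0.433845 - 1) \<ge> (2.65652::real)"
    by (rule order_trans[rotated])
  then have "omega_bound 0.433845 \<ge> 0.433845\<^sup>2 * 2.65652"
    unfolding omega_bound_def by (intro mult_left_mono) auto
  moreover have "0.433845\<^sup>2 * 2.65652 > (1 / 2 :: real)" by (simp add: power2_eq_square)
  ultimately show ?thesis by linarith
qed

lemma omega_radius_exists:
  obtains r where "0.433835 < r" "r < 0.433845" "omega_bound r = 1 / 2"
proof -
  have "continuous_on {0.433835..0.433845} omega_bound"
    unfolding omega_bound_def by (intro continuous_intros)
  then obtain r where r: "0.433835 \<le> r" "r \<le> 0.433845" "omega_bound r = 1 / 2"
    using IVT'[of omega_bound "0.433835" "1 / 2" "0.433845"] omega_bound_lower omega_bound_upper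
    by auto
  moreover have "r \<noteq> 0.433835" "r \<noteq> 0.433845"
    using r(3) omega_bound_lower omega_bound_upper by (metis less_irrefl)+
  ultimately show thesis using that[of r] by force
qed

text \<open>Comparing derivatives replaces integration: along the ray through \<open>z\<close>, the
  real part of \<open>g\<close> minus \<open>\<phi>\<close> never increases. The bound is asked only
  off the origin, where the differential equation for \<open>f\<close> can be divided by
  \<open>z\<close>.\<close>

lemma Re_radial_growth:
  fixes \<phi> \<phi>' :: "real \<Rightarrow> real"
  assumes hol: "g holomorphic_on ball 0 R"
    and deriv_\<phi>: "\<And>t. (\<phi> has_real_derivative \<phi>' t) (at t)"
    and bound: "\<And>z. z \<noteq> 0 \<Longrightarrow> norm z < R \<Longrightarrow> norm (deriv g z) \<le> \<phi>' (norm z)"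
    and z: "norm z < R"
  shows "Re (g z) - Re (g 0) \<le> \<phi> (norm z) - \<phi> 0"
proof (cases "z = 0")
  case False
  define u where "u = z / of_real (norm z)"
  have norm_u: "norm u = 1" using False by (simp add: u_def norm_divide)
  have zu: "z = of_real (norm z) * u" using False by (simp add: u_def)
  define \<psi> where "\<psi> t = Re (g (of_real t * u)) - \<phi> t" for t
  have deriv_\<psi>: "(\<psi> has_real_derivative Re (u * deriv g (of_real t * u)) - \<phi>' t) (at t)"
    if "0 \<le> t" "t \<le> norm z" for t
  proof -
    have "(g has_field_derivative deriv g (of_real t * u)) (at (of_real t * u))"
      using that z norm_u by (intro holomorphic_derivI[OF hol]) (auto simp: norm_mult)
    moreover have "((\<lambda>t. of_real t * u) has_vector_derivative u) (at t)"
      by (auto intro!: derivative_eq_intros)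
    ultimately have "((\<lambda>t. g (of_real t * u)) has_vector_derivative u * deriv g (of_real t * u)) (at t)"
      using field_vector_diff_chain_at[of "\<lambda>t. of_real t * u" u t g] by (simp add: o_def)
    then show ?thesis
      unfolding \<psi>_def by (intro DERIV_diff has_field_derivative_Re deriv_\<phi>)
  qed
  \<comment> \<open>Monotonicity needs the derivative's sign only in the open interval, so the
    missing bound at the origin does no harm.\<close>
  have "\<psi> 0 \<ge> \<psi> (norm z)"
  proof (rule DERIV_nonpos_imp_decreasing_open[of 0 "norm z" \<psi>])
    show "continuous_on {0..norm z} \<psi>"
      using deriv_\<psi> by (intro continuous_at_imp_continuous_on ballI DERIV_isCont) auto
  next
    fix t assume t: "0 < t" "t < norm z"
    have "Re (u * deriv g (of_real t * u)) \<le> norm (deriv g (of_real t * u))"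
      using complex_Re_le_cmod[of "u * deriv g (of_real t * u)"] norm_u by (simp add: norm_mult)
    also have "\<dots> \<le> \<phi>' t"
      using bound[of "of_real t * u"] t z norm_u by (cases "u = 0") (auto simp: norm_mult)
    finally show "\<exists>y. (\<psi> has_real_derivative y) (at t) \<and> y \<le> 0"
      using deriv_\<psi>[of t] t by (intro exI conjI) auto
  qed auto
  then show ?thesis using zu by (simp add: \<psi>_def)
qed auto

text \<open>Clearing the denominator is legitimate because \<open>f\<close> has no zero off the
  origin.\<close>

lemma class_S_wpE:
  assumes "f \<in> class_S_wp"
  obtains \<omega> where "\<And>z. norm z < 1 \<Longrightarrow> norm (\<omega> z) \<le> norm z"
    and "\<And>z. z \<noteq> 0 \<Longrightarrow> norm z < 1 \<Longrightarrow> z * deriv f z = f z * (1 + \<omega> z * exp (\<omega> z))"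
proof -
  obtain \<omega> where \<omega>: "\<omega> holomorphic_on unit_disc" "\<omega> ` unit_disc \<subseteq> unit_disc" "\<omega> 0 = 0"
    and sub: "\<forall>z\<in>unit_disc. starlike_quotient f z = 1 + \<omega> z * exp (\<omega> z)"
    using assms unfolding class_S_wp_def subordinate_def by auto
  have "norm (\<omega> z) < 1" if "norm z < 1" for z
    using \<omega>(2) that by (auto simp: image_subset_iff)
  then have "norm (\<omega> z) \<le> norm z" if "norm z < 1" for z
    using Schwarz_Lemma(1)[of \<omega>] \<omega> that by blast
  moreover have "z * deriv f z = f z * (1 + \<omega> z * exp (\<omega> z))" if "z \<noteq> 0" "norm z < 1" for z
  proof -
    have "f z \<noteq> 0" using assms that by (auto simp: class_S_wp_def)
    moreover have "z * deriv f z / f z = 1 + \<omega> z * exp (\<omega> z)"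
      using bspec[OF sub, of z] that by (simp add: starlike_quotient_def)
    ultimately show ?thesis by (simp add: field_simps)
  qed
  ultimately show thesis by (rule that)
qed

lemma norm_mult_exp_le:
  fixes w :: complex
  assumes "norm w \<le> r"
  shows "norm (w * exp w) \<le> r * exp r"
proof -
  have "norm (exp w) \<le> exp r"
    using norm_exp[of w] assms by (meson exp_le_cancel_iff order_trans)
  then show ?thesis
    unfolding norm_mult using assms order_trans[OF norm_ge_zero assms] by (intro mult_mono) auto
qed

lemma class_S_wp_growth:
  assumes f: "f \<in> class_S_wp" and z: "norm z < 1"
  shows "norm (f z) \<le> norm z * exp (exp (norm z) - 1)"
proof -
  have hol: "f holomorphic_on unit_disc" and f0: "f 0 = 0" and f'0: "deriv f 0 = 1"
    and nz: "\<forall>z\<in>unit_disc - {0}. f z \<noteq> 0"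
    using f by (auto simp: class_S_wp_def class_A_def)
  obtain \<omega> where schwarz: "\<And>z. norm z < 1 \<Longrightarrow> norm (\<omega> z) \<le> norm z"
    and ode: "\<And>z. z \<noteq> 0 \<Longrightarrow> norm z < 1 \<Longrightarrow> z * deriv f z = f z * (1 + \<omega> z * exp (\<omega> z))"
    using class_S_wpE[OF f] by blast
  \<comment> \<open>The value 1 is \<open>deriv f 0\<close>, which removes the singularity;
    \<open>h\<close> is then zero-free and has a holomorphic logarithm on the disc.\<close>
  define h where "h w = (if w = 0 then 1 else f w / w)" for w
  have "h = (\<lambda>w. if w = 0 then deriv f 0 else (f w - f 0) / (w - 0))"
    by (auto simp: h_def f0 f'0)
  then have "h holomorphic_on unit_disc"
    using pole_lemma_open[OF hol open_ball, of 0] by simp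
  moreover have "h w \<noteq> 0" if "w \<in> unit_disc" for w
    using nz that by (auto simp: h_def)
  ultimately obtain g where g: "g holomorphic_on unit_disc"
    and exp_g: "\<And>w. w \<in> unit_disc \<Longrightarrow> exp (g w) = h w"
    using holomorphic_logarithm_exists[of unit_disc h 0] by auto
  have f_eq: "f w = w * exp (g w)" if "w \<in> unit_disc" for w
    using exp_g[OF that] by (auto simp: h_def f0)
  have "norm (deriv g w) \<le> exp (norm w)" if w: "w \<noteq> 0" "norm w < 1" for w
  proof -
    have "((\<lambda>w. w * exp (g w)) has_field_derivative exp (g w) * (1 + w * deriv g w)) (at w)"
      using w by (auto intro!: derivative_eq_intros holomorphic_derivI[OF g open_ball]
          simp: algebra_simps)
    then have "(f has_field_derivative exp (g w) * (1 + w * deriv g w)) (at w)"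
      by (rule has_field_derivative_transform_within_open[where S = unit_disc])
         (use w f_eq in auto)
    then have "deriv f w = exp (g w) * (1 + w * deriv g w)" by (rule DERIV_imp_deriv)
    then have "w * deriv g w = \<omega> w * exp (\<omega> w)"
      using ode[OF w] f_eq[of w] w by simp
    then have "norm w * norm (deriv g w) \<le> norm w * exp (norm w)"
      using norm_mult_exp_le[OF schwarz[OF w(2)]] by (simp flip: norm_mult)
    then show ?thesis using w by simp
  qed
  then have "Re (g z) - Re (g 0) \<le> exp (norm z) - exp 0"
    by (rule Re_radial_growth[OF g DERIV_exp _ z])
  \<comment> \<open>The branch of the logarithm is fixed only up to multiples of 2 pi i, but
    \<open>h 0 = 1\<close> determines the real part.\<close>
  moreover have "Re (g 0) = 0"
    using exp_g[of 0] norm_exp_eq_Re[of "g 0"] by (simp add: h_def)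
  ultimately have "norm (exp (g z)) \<le> exp (exp (norm z) - 1)" by simp
  then show ?thesis using f_eq[of z] z by (simp add: norm_mult mult_left_mono)
qed

text \<open>The differential equation factors the difference as \<open>f z\<close> times
  \<open>\<omega> z * exp (\<omega> z)\<close>, and each factor is bounded separately.\<close>

lemma class_S_wp_omega_bound:
  assumes f: "f \<in> class_S_wp" and z: "norm z < 1"
  shows "norm (z * deriv f z - f z) \<le> omega_bound (norm z)"
proof (cases "z = 0")
  case True
  then show ?thesis
    using f by (simp add: class_S_wp_def class_A_def omega_bound_def)
next
  case False
  obtain \<omega> where schwarz: "\<And>z. norm z < 1 \<Longrightarrow> norm (\<omega> z) \<le> norm z"
    and ode: "\<And>z. z \<noteq> 0 \<Longrightarrow> norm z < 1 \<Longrightarrow> z * deriv f z = f z * (1 + \<omega> z * exp (\<omega> z))"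
    using class_S_wpE[OF f] by blast
  have "norm (z * deriv f z - f z) = norm (f z) * norm (\<omega> z * exp (\<omega> z))"
    using ode[OF False z] by (simp add: algebra_simps flip: norm_mult)
  also have "\<dots> \<le> (norm z * exp (exp (norm z) - 1)) * (norm z * exp (norm z))"
    by (intro mult_mono class_S_wp_growth[OF f z] norm_mult_exp_le schwarz z) auto
  also have "\<dots> = omega_bound (norm z)"
    by (simp add: omega_bound_def power2_eq_square exp_add exp_diff)
  finally show ?thesis .
qed

text \<open>The normalized solution of the differential equation for \<open>\<omega> z = z\<close>,
  the equality case of the Schwarz lemma.\<close>

definition extremal :: "complex \<Rightarrow> complex" where
  "extremal z = z * exp (exp z - 1)"

lemma deriv_extremal: "deriv extremal z = exp (exp z - 1) * (1 + z * exp z)"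
  unfolding extremal_def
  by (rule DERIV_imp_deriv) (auto intro!: derivative_eq_intros simp: algebra_simps)

lemma extremal_in_class_S_wp: "extremal \<in> class_S_wp"
proof -
  have "extremal holomorphic_on unit_disc"
    unfolding extremal_def by (intro holomorphic_intros)
  then have "extremal \<in> class_A"
    by (simp add: class_A_def deriv_extremal) (simp add: extremal_def)
  moreover have "starlike_quotient extremal z = 1 + z * exp z" for z
    by (simp add: starlike_quotient_def deriv_extremal) (simp add: extremal_def)
  then have "subordinate (starlike_quotient extremal) (\<lambda>z. 1 + z * exp z)"
    unfolding subordinate_def by (intro exI[of _ "\<lambda>z. z"]) (auto intro: holomorphic_on_ident)
  ultimately show ?thesis by (simp add: class_S_wp_def extremal_def)
qed

lemma extremal_omega_bound:
  "of_real r * deriv extremal (of_real r) - extremal (of_real r) = of_real (omega_bound r)"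
  unfolding deriv_extremal extremal_def omega_bound_def
  by (simp add: algebra_simps power2_eq_square exp_add exp_diff flip: exp_of_real)

theorem theorem2p17:
  shows "\<exists>r0::real.
    0 < r0 \<and> 2 * r0\<^sup>2 * exp (exp r0 + r0 - 1) - 1 = 0 \<and>
    (\<forall>r::real. 0 < r \<and> 2 * r\<^sup>2 * exp (exp r + r - 1) - 1 = 0 \<longrightarrow> r0 \<le> r) \<and>
    \<bar>r0 - 0.43384\<bar> < 0.000005 \<and>
    (\<forall>f\<in>class_S_wp. in_Omega_disc r0 f) \<and>
    (\<forall>\<rho>>r0. \<exists>f\<in>class_S_wp. \<not> in_Omega_disc \<rho> f)"
proof -
  obtain r0 where r0: "0.433835 < r0" "r0 < 0.433845" "omega_bound r0 = 1 / 2"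
    by (rule omega_radius_exists)
  have root_iff: "2 * r\<^sup>2 * exp (exp r + r - 1) - 1 = 0 \<longleftrightarrow> omega_bound r = 1 / 2" for r
    by (auto simp: omega_bound_def)
  \<comment> \<open>A smaller positive root would contradict strict monotonicity.\<close>
  have "r0 \<le> r" if "0 < r" "omega_bound r = 1 / 2" for r
    using omega_bound_strict_mono[of r r0] that r0(3) by (cases "r < r0") auto
  moreover have "\<bar>r0 - 0.43384\<bar> < 0.000005"
    using r0 unfolding abs_less_iff by simp
  moreover have "in_Omega_disc r0 f" if f: "f \<in> class_S_wp" for f
  proof -
    have "norm (z * deriv f z - f z) < 1 / 2" if "norm z < 1" "norm z < r0" for z
      using class_S_wp_omega_bound[OF f that(1)] omega_bound_strict_mono[of "norm z" r0] that(2) r0(3)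
      by simp
    then show ?thesis using f by (auto simp: in_Omega_disc_def class_S_wp_def)
  qed
  moreover have "\<not> in_Omega_disc \<rho> extremal" if "\<rho> > r0" for \<rho>
  proof
    \<comment> \<open>The real point \<open>r0\<close> lies in both discs, and there the extremal
      function attains exactly 1/2, violating the strict inequality.\<close>
    assume "in_Omega_disc \<rho> extremal"
    then have "norm (of_real r0 * deriv extremal (of_real r0) - extremal (of_real r0)) < 1 / 2"
      using that r0 unfolding in_Omega_disc_def by force
    then show False unfolding extremal_omega_bound by (simp add: r0(3))
  qed
  ultimately show ?thesis
    using r0 extremal_in_class_S_wp unfolding root_iff
    by (intro exI[of _ r0] conjI) auto
qed

end
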